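(* Let $N\ge1$ and $G>0$. The coefficient matrices $A_G(U)=A_L(U)+\Delta A(U)$ and $B_G(U)=B_L(U)+\Delta B(U)$ of the $G$-SWLME satisfy $$\cos\theta\,A_G(U)+\sin\theta\,B_G(U)=T(\theta)^{-1}A_G(T(\theta)U)\,T(\theta)$$ for all $\theta\in[0,2\pi)$ and all $U\in\mathcal A_N$.
   Context: State space: $\mathcal A_N=\{U\in\mathbb R^{2N+3}: h>0\}$, where $$U=(h,hu_m,hv_m,h\alpha_1,h\beta_1,\ldots,h\alpha_N,h\beta_N)^T,$$ so that $u_m,v_m,\alpha_j,\beta_j$ are the functions of $U$ obtained by dividing the corresponding component by $h$. SWLME matrices: $A_L(U)=\partial_UF_L(U)+P_1(U)$, $B_L(U)=\partial_UG_L(U)+Q_1(U)$ ($\partial_U$ is the Jacobian with respect to the components of $U$), where $$F_L(U)=\Big(hu_m,\;h\big(u_m^2+\sum_{j=1}^N\tfrac{\alpha_j^2}{2j+1}\big)+\tfrac12Gh^2,\;h\big(u_mv_m+\sum_{j=1}^N\tfrac{\alpha_j\beta_j}{2j+1}\big),\;2hu_m\alpha_1,\;h(u_m\beta_1+v_m\alpha_1),\ldots,2hu_m\alpha_N,\;h(u_m\beta_N+v_m\alpha_N)\Big)^T,$$ $$G_L(U)=\Big(hv_m,\;h\big(u_mv_m+\sum_{j=1}^N\tfrac{\alpha_j\beta_j}{2j+1}\big),\;h\big(v_m^2+\sum_{j=1}^N\tfrac{\beta_j^2}{2j+1}\big)+\tfrac12Gh^2,\;h(u_m\beta_1+v_m\alpha_1),\;2hv_m\beta_1,\ldots,h(u_m\beta_N+v_m\alpha_N),\;2hv_m\beta_N\Big)^T,$$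 and $P_1(U)=\mathrm{diag}(0_{3\times3},p(U),\ldots,p(U))$, $Q_1(U)=\mathrm{diag}(0_{3\times3},q(U),\ldots,q(U))$ (block diagonal, $N$ copies of the $2\times2$ block) with $$p(U)=\begin{pmatrix}-u_m&0\\-v_m&0\end{pmatrix},\qquad q(U)=\begin{pmatrix}0&-u_m\\0&-v_m\end{pmatrix}.$$ Corrections: index the horizontal vector pairs by $0,1,\ldots,N$, where pair $0$ is $(hu_m,hv_m)$ and pair $j\ge1$ is $(h\alpha_j,h\beta_j)$; $(M)_{kl}$ denotes the $2\times2$ block of $M$ with rows of pair $k$ and columns of pair $l$. The only nonzero entries of $\Delta A(U),\Delta B(U)\in\mathbb R^{(2N+3)\times(2N+3)}$ are in the blocks, for $j=1,\ldots,N$, $$(\Delta A)_{0j}=\frac1{2j+1}\begin{pmatrix}0&0\\-\beta_j&\alpha_j\end{pmatrix},\qquad(\Delta B)_{0j}=\frac1{2j+1}\begin{pmatrix}\beta_j&-\alpha_j\\0&0\end{pmatrix};$$ all other entries vanish. Rotation: $T_2(\theta)=\begin{pmatrix}\cos\theta&\sin\theta\\-\sin\theta&\cos\theta\end{pmatrix}$ and $T(\theta)=\mathrm{diag}(1,T_2(\theta),\ldots,T_2(\theta))\in\mathbb R^{(2N+3)\times(2N+3)}$ (with $N+1$ copies of $T_2(\theta)$). *)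

theory Defs
  imports
    "HOL-Analysis.Derivative"
    "Jordan_Normal_Form.Gauss_Jordan_Elimination"
begin

text \<open>
  A state is a vector \<open>U = (h, h u\<^sub>m, h v\<^sub>m, h \<alpha>\<^sub>1, h \<beta>\<^sub>1, \<dots>, h \<alpha>\<^sub>N, h \<beta>\<^sub>N)\<close> with entries numbered
  from 0.  Pair \<open>j\<close> (\<open>j = 0\<close> for \<open>(h u\<^sub>m, h v\<^sub>m)\<close>, \<open>j = 1, \<dots>, N\<close> for \<open>(h \<alpha>\<^sub>j, h \<beta>\<^sub>j)\<close>) therefore
  occupies the entries \<open>2 * j + 1\<close> and \<open>2 * j + 2\<close>, and entry \<open>i > 0\<close> belongs to pair
  \<open>(i - 1) div 2\<close>, at position \<open>(i - 1) mod 2\<close>.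
\<close>

definition state_space :: "nat \<Rightarrow> real vec set" where
  "state_space N = {U \<in> carrier_vec (2 * N + 3). vec_index U 0 > 0}"

definition ht :: "real vec \<Rightarrow> real" where
  "ht U = vec_index U 0"

definition um :: "real vec \<Rightarrow> real" where
  "um U = vec_index U 1 / ht U"

definition vm :: "real vec \<Rightarrow> real" where
  "vm U = vec_index U 2 / ht U"

definition alpha :: "nat \<Rightarrow> real vec \<Rightarrow> real" where
  "alpha j U = vec_index U (2 * j + 1) / ht U"

definition beta :: "nat \<Rightarrow> real vec \<Rightarrow> real" where
  "beta j U = vec_index U (2 * j + 2) / ht U"

definition F_L :: "nat \<Rightarrow> real \<Rightarrow> real vec \<Rightarrow> real vec" where
  "F_L N G U = vec (2 * N + 3) (\<lambda>i.
     if i = 0 then ht U * um U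
     else if i = 1 then
       ht U * ((um U)\<^sup>2 + (\<Sum>j = 1..N. (alpha j U)\<^sup>2 / real (2 * j + 1))) + 1 / 2 * G * (ht U)\<^sup>2
     else if i = 2 then
       ht U * (um U * vm U + (\<Sum>j = 1..N. alpha j U * beta j U / real (2 * j + 1)))
     else let j = (i - 1) div 2 in
       if (i - 1) mod 2 = 0 then 2 * ht U * um U * alpha j U
       else ht U * (um U * beta j U + vm U * alpha j U))"

definition G_L :: "nat \<Rightarrow> real \<Rightarrow> real vec \<Rightarrow> real vec" where
  "G_L N G U = vec (2 * N + 3) (\<lambda>i.
     if i = 0 then ht U * vm U
     else if i = 1 then
       ht U * (um U * vm U + (\<Sum>j = 1..N. alpha j U * beta j U / real (2 * j + 1)))
     else if i = 2 then
       ht U * ((vm U)\<^sup>2 + (\<Sum>j = 1..N. (beta j U)\<^sup>2 / real (2 * j + 1))) + 1 / 2 * G * (ht U)\<^sup>2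
     else let j = (i - 1) div 2 in
       if (i - 1) mod 2 = 0 then ht U * (um U * beta j U + vm U * alpha j U)
       else 2 * ht U * vm U * beta j U)"

text \<open>
  The Jacobian matrix is the matrix of partial derivatives: entry \<open>(i, k)\<close> is the derivative of
  the \<open>i\<close>-th component in the direction of the \<open>k\<close>-th unit vector.
\<close>

definition jacobian_mat :: "(real vec \<Rightarrow> real vec) \<Rightarrow> real vec \<Rightarrow> real mat" where
  "jacobian_mat f U = mat (dim_vec (f U)) (dim_vec U)
     (\<lambda>(i, k). deriv (\<lambda>t. vec_index (f (U + t \<cdot>\<^sub>v unit_vec (dim_vec U) k)) i) 0)"

definition p_block :: "real vec \<Rightarrow> real mat" where
  "p_block U = mat_of_rows_list 2 [[- um U, 0], [- vm U, 0]]"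

definition q_block :: "real vec \<Rightarrow> real mat" where
  "q_block U = mat_of_rows_list 2 [[0, - um U], [0, - vm U]]"

definition P_1 :: "nat \<Rightarrow> real vec \<Rightarrow> real mat" where
  "P_1 N U = diag_block_mat (0\<^sub>m 3 3 # replicate N (p_block U))"

definition Q_1 :: "nat \<Rightarrow> real vec \<Rightarrow> real mat" where
  "Q_1 N U = diag_block_mat (0\<^sub>m 3 3 # replicate N (q_block U))"

definition A_L :: "nat \<Rightarrow> real \<Rightarrow> real vec \<Rightarrow> real mat" where
  "A_L N G U = jacobian_mat (F_L N G) U + P_1 N U"

definition B_L :: "nat \<Rightarrow> real \<Rightarrow> real vec \<Rightarrow> real mat" where
  "B_L N G U = jacobian_mat (G_L N G) U + Q_1 N U"

definition DA_block :: "nat \<Rightarrow> real vec \<Rightarrow> real mat" where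
  "DA_block j U = (1 / real (2 * j + 1)) \<cdot>\<^sub>m mat_of_rows_list 2 [[0, 0], [- beta j U, alpha j U]]"

definition DB_block :: "nat \<Rightarrow> real vec \<Rightarrow> real mat" where
  "DB_block j U = (1 / real (2 * j + 1)) \<cdot>\<^sub>m mat_of_rows_list 2 [[beta j U, - alpha j U], [0, 0]]"

text \<open>
  The matrix of size \<open>2 * N + 3\<close> whose block with rows of pair 0 and columns of pair \<open>j\<close> is
  \<open>D j\<close>, for \<open>j = 1, \<dots>, N\<close>, and whose other entries vanish.
\<close>

definition row_zero_blocks :: "nat \<Rightarrow> (nat \<Rightarrow> real mat) \<Rightarrow> real mat" where
  "row_zero_blocks N D = mat (2 * N + 3) (2 * N + 3) (\<lambda>(r, c).
     if r \<in> {1, 2} \<and> c \<ge> 3 then D ((c - 1) div 2) $$ (r - 1, (c - 1) mod 2) else 0)"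

definition Delta_A :: "nat \<Rightarrow> real vec \<Rightarrow> real mat" where
  "Delta_A N U = row_zero_blocks N (\<lambda>j. DA_block j U)"

definition Delta_B :: "nat \<Rightarrow> real vec \<Rightarrow> real mat" where
  "Delta_B N U = row_zero_blocks N (\<lambda>j. DB_block j U)"

definition A_G :: "nat \<Rightarrow> real \<Rightarrow> real vec \<Rightarrow> real mat" where
  "A_G N G U = A_L N G U + Delta_A N U"

definition B_G :: "nat \<Rightarrow> real \<Rightarrow> real vec \<Rightarrow> real mat" where
  "B_G N G U = B_L N G U + Delta_B N U"

definition T_2 :: "real \<Rightarrow> real mat" where
  "T_2 \<theta> = mat_of_rows_list 2 [[cos \<theta>, sin \<theta>], [- sin \<theta>, cos \<theta>]]"

definition T_rot :: "nat \<Rightarrow> real \<Rightarrow> real mat" where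
  "T_rot N \<theta> = diag_block_mat (1\<^sub>m 1 # replicate (N + 1) (T_2 \<theta>))"

end

theory Submission
  imports Defs
begin

text \<open>
  For a direction \<open>n\<close>, the combination \<open>n\<^sub>0 A_G + n\<^sub>1 B_G\<close> has a coordinate-free form: with
  \<open>w = (u\<^sub>m, v\<^sub>m)\<close> and \<open>g\<^sub>j = (\<alpha>\<^sub>j, \<beta>\<^sub>j)\<close> its blocks only involve inner products with \<open>n\<close>, the
  identity, and the rank-one matrices \<open>w n\<^sup>T\<close> and \<open>g\<^sub>j n\<^sup>T\<close>.  (The corrections and the
  nonconservative terms turn the blocks for the pairs \<open>(0, j)\<close> and \<open>(j, j)\<close> into multiples of the
  identity.)  Such a matrix is equivariant when \<open>n\<close> and all pairs are rotated simultaneously, and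
  \<open>T\<^sub>2 \<theta>\<close> maps \<open>(cos \<theta>, sin \<theta>)\<close> to \<open>(1, 0)\<close>.
\<close>

section \<open>The flux and the coefficient matrix in a direction \<open>n\<close>\<close>

definition pair_comp :: "real vec \<Rightarrow> nat \<Rightarrow> nat \<Rightarrow> real" where
  "pair_comp U j p = vec_index U (2 * j + 1 + p) / ht U"

definition normal_comp :: "(nat \<Rightarrow> real) \<Rightarrow> real vec \<Rightarrow> nat \<Rightarrow> real" where
  "normal_comp n U j = n 0 * pair_comp U j 0 + n 1 * pair_comp U j 1"

text \<open>This is component \<open>p\<close> of pair \<open>j\<close> of the flux in direction
  \<open>n\<close>. The two unit directions recover the corresponding entries of \<open>F_L\<close>
  and \<open>G_L\<close>, so one differentiation serves both fluxes.\<close>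

definition normal_flux_entry :: "nat \<Rightarrow> real \<Rightarrow> (nat \<Rightarrow> real) \<Rightarrow> real vec \<Rightarrow> nat \<Rightarrow> nat \<Rightarrow> real" where
  "normal_flux_entry N G n U j p =
     (if j = 0 then
        ht U * (normal_comp n U 0 * pair_comp U 0 p
          + (\<Sum>l = 1..N. normal_comp n U l * pair_comp U l p / real (2 * l + 1))) + 1 / 2 * G * (ht U)\<^sup>2 * n p
      else ht U * (normal_comp n U 0 * pair_comp U j p + normal_comp n U j * pair_comp U 0 p))"

text \<open>The column belonging to \<open>h\<close>. Apart from gravity, each flux term is, up to a
  constant, a product of two conserved components divided by \<open>h\<close>. Its
  \<open>h\<close>-derivative is therefore minus the product of the two quotients. The corrections
  and nonconservative terms vanish in this column.\<close>

definition normal_mat_column :: "nat \<Rightarrow> real \<Rightarrow> (nat \<Rightarrow> real) \<Rightarrow> real vec \<Rightarrow> nat \<Rightarrow> nat \<Rightarrow> real" where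
  "normal_mat_column N G n U j p =
     (if j = 0 then
        G * ht U * n p - (normal_comp n U 0 * pair_comp U 0 p
          + (\<Sum>l = 1..N. normal_comp n U l * pair_comp U l p / real (2 * l + 1)))
      else - (normal_comp n U 0 * pair_comp U j p + normal_comp n U j * pair_comp U 0 p))"

text \<open>With \<open>g_0 = w\<close>, the columns of pair 0 carry
  \<open>g_j n^T + (n . g_j) I\<close>. All other columns carry multiples of the identity whose
  coefficients depend on \<open>U\<close> and \<open>n\<close> only through inner products.\<close>

definition normal_mat_block :: "(nat \<Rightarrow> real) \<Rightarrow> real vec \<Rightarrow> nat \<Rightarrow> nat \<Rightarrow> nat \<Rightarrow> nat \<Rightarrow> real" where
  "normal_mat_block n U j p l q =
     (if l = 0 then pair_comp U j p * n q + of_bool (p = q) * normal_comp n U j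
      else of_bool (p = q) *
        (if j = 0 then 2 * normal_comp n U l / real (2 * l + 1)
         else of_bool (j = l) * normal_comp n U 0))"

definition normal_mat :: "nat \<Rightarrow> real \<Rightarrow> (nat \<Rightarrow> real) \<Rightarrow> real vec \<Rightarrow> real mat" where
  "normal_mat N G n U = mat (2 * N + 3) (2 * N + 3) (\<lambda>(i, k).
     if i = 0 then (if k \<in> {1, 2} then n (k - 1) else 0)
     else if k = 0 then normal_mat_column N G n U ((i - 1) div 2) ((i - 1) mod 2)
     else normal_mat_block n U ((i - 1) div 2) ((i - 1) mod 2) ((k - 1) div 2) ((k - 1) mod 2))"

section \<open>Indices grouped by pairs, and block diagonal matrices\<close>

lemma index_cases:
  fixes i N :: nat
  assumes "i < 2 * N + 3"
  obtains "i = 0" | j p where "j \<le> N" "p < 2" "i = 2 * j + 1 + p"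
proof (cases "i = 0")
  case False
  then obtain m where m: "i = Suc m" by (cases i) auto
  have "m div 2 < N + 1"
    using assms m by (intro less_mult_imp_div_less) simp
  then show ?thesis
    using that(2)[of "m div 2" "m mod 2"] m by simp
qed (use that(1) in blast)

lemma pair_index_eq_iff:
  fixes j l p q :: nat
  assumes "p < 2" "q < 2"
  shows "2 * j + 1 + p = 2 * l + 1 + q \<longleftrightarrow> j = l \<and> p = q"
proof
  assume "2 * j + 1 + p = 2 * l + 1 + q"
  then have "p + 2 * j = q + 2 * l" by simp
  then have "(p + 2 * j) div 2 = (q + 2 * l) div 2" "(p + 2 * j) mod 2 = (q + 2 * l) mod 2"
    by simp_all
  then show "j = l \<and> p = q" using assms by simp
qed simp

lemma diag_block_replicate_dims:
  assumes "A \<in> carrier_mat m m"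
  shows "diag_block_mat (replicate n A) \<in> carrier_mat (n * m) (n * m)"
  using assms by (induction n) (auto simp: Let_def)

lemma diag_block_replicate_index:
  assumes "A \<in> carrier_mat m m" "j < n" "l < n" "p < m" "q < m"
  shows "diag_block_mat (replicate n A) $$ (j * m + p, l * m + q) = (if j = l then A $$ (p, q) else 0)"
  using assms(2,3)
proof (induction n arbitrary: j l)
  case (Suc n)
  \<comment> \<open>Position \<open>r\<close> inside block \<open>i\<close> stays inside the first
    \<open>k\<close> blocks. This range condition is needed before the outermost block split can be
    evaluated.\<close>
  have bound: "i * m + r < k * m" if "i < k" "r < m" for i r k :: nat
  proof -
    have "i * m + r < Suc i * m" using that by simp
    also have "\<dots> \<le> k * m" using that by (intro mult_right_mono) auto
    finally show ?thesis .
  qed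
  have bounds: "j * m + p < Suc n * m" "l * m + q < Suc n * m"
    using bound Suc.prems assms(4,5) by blast+
  have dims: "dim_row (diag_block_mat (replicate n A)) = n * m"
    "dim_col (diag_block_mat (replicate n A)) = n * m"
    using diag_block_replicate_dims[OF assms(1)] by auto
  \<comment> \<open>Removing the first copy lowers both block numbers by one. If exactly one of
    \<open>j\<close> and \<open>l\<close> is 0, the entry lies in an off-diagonal zero
    block.\<close>
  show ?case
    using Suc bounds assms(1,4,5) dims
    by (cases j; cases l) (auto simp: Let_def add.assoc)
qed simp

lemma diag_block_Cons_index:
  assumes "B \<in> carrier_mat b b" "A \<in> carrier_mat m m" "i < b + n * m" "k < b + n * m"
  shows "diag_block_mat (B # replicate n A) $$ (i, k) =
    (if i < b then if k < b then B $$ (i, k) else 0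
     else if k < b then 0 else diag_block_mat (replicate n A) $$ (i - b, k - b))"
  using assms diag_block_replicate_dims[OF assms(2), of n] by (auto simp: Let_def)

lemma diag_block_Cons_carrier:
  assumes "B \<in> carrier_mat b b" "A \<in> carrier_mat m m"
  shows "diag_block_mat (B # replicate n A) \<in> carrier_mat (b + n * m) (b + n * m)"
  using assms diag_block_replicate_dims[OF assms(2), of n] by (auto simp: Let_def)

lemma T_2_carrier: "T_2 \<theta> \<in> carrier_mat 2 2"
  by (simp add: T_2_def mat_of_rows_list_def numeral_2_eq_2)

lemma T_rot_carrier: "T_rot N \<theta> \<in> carrier_mat (2 * N + 3) (2 * N + 3)"
proof -
  have "2 * N + 3 = 1 + (N + 1) * 2" by simp
  then show ?thesis
    unfolding T_rot_def by (simp only: diag_block_Cons_carrier[OF one_carrier_mat T_2_carrier])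
qed

lemma T_rot_index:
  "T_rot N \<theta> $$ (0, 0) = 1"
  "l \<le> N \<Longrightarrow> q < 2 \<Longrightarrow> T_rot N \<theta> $$ (0, 2 * l + 1 + q) = 0"
  "j \<le> N \<Longrightarrow> p < 2 \<Longrightarrow> T_rot N \<theta> $$ (2 * j + 1 + p, 0) = 0"
  "j \<le> N \<Longrightarrow> p < 2 \<Longrightarrow> l \<le> N \<Longrightarrow> q < 2 \<Longrightarrow>
     T_rot N \<theta> $$ (2 * j + 1 + p, 2 * l + 1 + q) = of_bool (j = l) * T_2 \<theta> $$ (p, q)"
  unfolding T_rot_def
  using diag_block_replicate_index[OF T_2_carrier, of j "N + 1" l p q \<theta>]
  by (subst diag_block_Cons_index[OF one_carrier_mat T_2_carrier];
      auto simp: mult.commute)+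

lemma sum_pairs:
  fixes f :: "nat \<Rightarrow> 'a::comm_monoid_add"
  shows "(\<Sum>i<2 * N + 3. f i) = f 0 + (\<Sum>j\<le>N. f (2 * j + 1) + f (2 * j + 2))"
  by (induction N) (simp_all add: numeral_eq_Suc add.assoc)

lemma p_q_block_carrier: "p_block U \<in> carrier_mat 2 2" "q_block U \<in> carrier_mat 2 2"
  by (simp_all add: p_block_def q_block_def mat_of_rows_list_def numeral_2_eq_2)

lemma diag_zero_block_index:
  fixes N :: nat and A :: "real mat"
  assumes "A \<in> carrier_mat 2 2"
  defines "D \<equiv> diag_block_mat (0\<^sub>m 3 3 # replicate N A)"
  shows "D \<in> carrier_mat (2 * N + 3) (2 * N + 3)"
    "k < 2 * N + 3 \<Longrightarrow> D $$ (0, k) = 0"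
    "i < 2 * N + 3 \<Longrightarrow> D $$ (i, 0) = 0"
    "j \<le> N \<Longrightarrow> p < 2 \<Longrightarrow> l \<le> N \<Longrightarrow> q < 2 \<Longrightarrow>
       D $$ (2 * j + 1 + p, 2 * l + 1 + q) = of_bool (j = l \<and> j \<noteq> 0) * A $$ (p, q)"
proof -
  show "D \<in> carrier_mat (2 * N + 3) (2 * N + 3)"
    using diag_block_Cons_carrier[OF zero_carrier_mat assms(1), of 3 N]
    unfolding D_def by (simp only: mult.commute add.commute)
  show "k < 2 * N + 3 \<Longrightarrow> D $$ (0, k) = 0" "i < 2 * N + 3 \<Longrightarrow> D $$ (i, 0) = 0"
    unfolding D_def
    by (subst diag_block_Cons_index[OF zero_carrier_mat assms(1)]; simp)+
  \<comment> \<open>The leading zero block of size 3 covers \<open>h\<close> and pair 0, so pair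
    \<open>j\<close> with \<open>j > 0\<close> sits in copy number \<open>j - 1\<close>.\<close>
  show "D $$ (2 * j + 1 + p, 2 * l + 1 + q) = of_bool (j = l \<and> j \<noteq> 0) * A $$ (p, q)"
    if "j \<le> N" "p < 2" "l \<le> N" "q < 2"
    using that diag_block_replicate_index[OF assms(1), of "j - 1" N "l - 1" p q]
    unfolding D_def
    by (subst diag_block_Cons_index[OF zero_carrier_mat assms(1)];
        cases j; cases l; auto simp: mult.commute)
qed


section \<open>Entries of products with the rotation matrix\<close>

lemma normal_mat_carrier: "normal_mat N G n U \<in> carrier_mat (2 * N + 3) (2 * N + 3)"
  by (simp add: normal_mat_def)

lemma normal_mat_index:
  "normal_mat N G n U $$ (0, 0) = 0"
  "l \<le> N \<Longrightarrow> q < 2 \<Longrightarrow> normal_mat N G n U $$ (0, 2 * l + 1 + q) = of_bool (l = 0) * n q"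
  "j \<le> N \<Longrightarrow> p < 2 \<Longrightarrow> normal_mat N G n U $$ (2 * j + 1 + p, 0) = normal_mat_column N G n U j p"
  "j \<le> N \<Longrightarrow> p < 2 \<Longrightarrow> l \<le> N \<Longrightarrow> q < 2 \<Longrightarrow>
     normal_mat N G n U $$ (2 * j + 1 + p, 2 * l + 1 + q) = normal_mat_block n U j p l q"
  by (auto simp: normal_mat_def less_2_cases_iff)

lemma T_2_index:
  "T_2 \<theta> $$ (0, 0) = cos \<theta>" "T_2 \<theta> $$ (0, 1) = sin \<theta>"
  "T_2 \<theta> $$ (1, 0) = - sin \<theta>" "T_2 \<theta> $$ (1, 1) = cos \<theta>"
  by (simp_all add: T_2_def mat_of_rows_list_def)

lemma block_bound: "j \<le> N \<Longrightarrow> p < 2 \<Longrightarrow> 2 * j + 1 + p < 2 * N + 3" for j N p :: nat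
  by simp

text \<open>A row of \<open>T_rot\<close> is supported on the entry of \<open>h\<close> alone or on
  a single pair, so the sum collapses to one or two terms. Stated for arbitrary \<open>f\<close>,
  this computes products with vectors as well as with matrices.\<close>

lemma T_rot_row_sum:
  "(\<Sum>i<2 * N + 3. T_rot N \<theta> $$ (0, i) * f i) = f 0"
  "j \<le> N \<Longrightarrow> p < 2 \<Longrightarrow> (\<Sum>i<2 * N + 3. T_rot N \<theta> $$ (2 * j + 1 + p, i) * f i) =
     T_2 \<theta> $$ (p, 0) * f (2 * j + 1) + T_2 \<theta> $$ (p, 1) * f (2 * j + 2)"
proof -
  have "T_rot N \<theta> $$ (0, 2 * l + 1) = 0" "T_rot N \<theta> $$ (0, 2 * l + 2) = 0" if "l \<le> N" for l
    using that T_rot_index(2)[of l N 0 \<theta>] T_rot_index(2)[of l N 1 \<theta>] by simp_all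
  then show "(\<Sum>i<2 * N + 3. T_rot N \<theta> $$ (0, i) * f i) = f 0"
    unfolding sum_pairs by (simp add: T_rot_index(1))
next
  assume jp: "j \<le> N" "p < 2"
  have "T_rot N \<theta> $$ (2 * j + 1 + p, 2 * l + 1) = of_bool (j = l) * T_2 \<theta> $$ (p, 0)"
    "T_rot N \<theta> $$ (2 * j + 1 + p, 2 * l + 2) = of_bool (j = l) * T_2 \<theta> $$ (p, 1)"
    if "l \<le> N" for l
    using that jp T_rot_index(4)[of j N p l 0 \<theta>] T_rot_index(4)[of j N p l 1 \<theta>] by simp_all
  note terms = this
  have "(\<Sum>l\<le>N. T_rot N \<theta> $$ (2 * j + 1 + p, 2 * l + 1) * f (2 * l + 1)
      + T_rot N \<theta> $$ (2 * j + 1 + p, 2 * l + 2) * f (2 * l + 2)) =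
    (\<Sum>l\<le>N. if j = l then T_2 \<theta> $$ (p, 0) * f (2 * l + 1) + T_2 \<theta> $$ (p, 1) * f (2 * l + 2) else 0)"
    by (intro sum.cong refl) (use terms in auto)
  then show "(\<Sum>i<2 * N + 3. T_rot N \<theta> $$ (2 * j + 1 + p, i) * f i) =
     T_2 \<theta> $$ (p, 0) * f (2 * j + 1) + T_2 \<theta> $$ (p, 1) * f (2 * j + 2)"
    unfolding sum_pairs T_rot_index(3)[OF jp] using jp by simp
qed

lemma T_rot_column_sum:
  "(\<Sum>i<2 * N + 3. f i * T_rot N \<theta> $$ (i, 0)) = f 0"
  "l \<le> N \<Longrightarrow> q < 2 \<Longrightarrow> (\<Sum>i<2 * N + 3. f i * T_rot N \<theta> $$ (i, 2 * l + 1 + q)) =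
     f (2 * l + 1) * T_2 \<theta> $$ (0, q) + f (2 * l + 2) * T_2 \<theta> $$ (1, q)"
proof -
  have "T_rot N \<theta> $$ (2 * j + 1, 0) = 0" "T_rot N \<theta> $$ (2 * j + 2, 0) = 0" if "j \<le> N" for j
    using that T_rot_index(3)[of j N 0 \<theta>] T_rot_index(3)[of j N 1 \<theta>] by simp_all
  then show "(\<Sum>i<2 * N + 3. f i * T_rot N \<theta> $$ (i, 0)) = f 0"
    unfolding sum_pairs by (simp add: T_rot_index(1))
next
  assume lq: "l \<le> N" "q < 2"
  have "T_rot N \<theta> $$ (2 * j + 1, 2 * l + 1 + q) = of_bool (l = j) * T_2 \<theta> $$ (0, q)"
    "T_rot N \<theta> $$ (2 * j + 2, 2 * l + 1 + q) = of_bool (l = j) * T_2 \<theta> $$ (1, q)"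
    if "j \<le> N" for j
    using that lq T_rot_index(4)[of j N 0 l q \<theta>] T_rot_index(4)[of j N 1 l q \<theta>] by auto
  note terms = this
  have "(\<Sum>j\<le>N. f (2 * j + 1) * T_rot N \<theta> $$ (2 * j + 1, 2 * l + 1 + q)
      + f (2 * j + 2) * T_rot N \<theta> $$ (2 * j + 2, 2 * l + 1 + q)) =
    (\<Sum>j\<le>N. if l = j then f (2 * j + 1) * T_2 \<theta> $$ (0, q) + f (2 * j + 2) * T_2 \<theta> $$ (1, q) else 0)"
    by (intro sum.cong refl) (use terms in auto)
  then show "(\<Sum>i<2 * N + 3. f i * T_rot N \<theta> $$ (i, 2 * l + 1 + q)) =
     f (2 * l + 1) * T_2 \<theta> $$ (0, q) + f (2 * l + 2) * T_2 \<theta> $$ (1, q)"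
    unfolding sum_pairs T_rot_index(2)[OF lq] using lq by simp
qed

lemma mult_mat_index_sum:
  assumes "A \<in> carrier_mat a b" "B \<in> carrier_mat b c" "i < a" "k < c"
  shows "(A * B) $$ (i, k) = (\<Sum>r<b. A $$ (i, r) * B $$ (r, k))"
  using assms by (auto simp: scalar_prod_def atLeast0LessThan)

text \<open>Splits a matrix equation according to the scalar entry \<open>h\<close> and the pairs,
  the form in which all entries are known here.\<close>

lemma eq_mat_pairsI:
  assumes "A \<in> carrier_mat (2 * N + 3) (2 * N + 3)" "B \<in> carrier_mat (2 * N + 3) (2 * N + 3)"
    and "A $$ (0, 0) = B $$ (0, 0)"
    and "\<And>l q. l \<le> N \<Longrightarrow> q < 2 \<Longrightarrow> A $$ (0, 2 * l + 1 + q) = B $$ (0, 2 * l + 1 + q)"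
    and "\<And>j p. j \<le> N \<Longrightarrow> p < 2 \<Longrightarrow> A $$ (2 * j + 1 + p, 0) = B $$ (2 * j + 1 + p, 0)"
    and "\<And>j p l q. j \<le> N \<Longrightarrow> p < 2 \<Longrightarrow> l \<le> N \<Longrightarrow> q < 2 \<Longrightarrow>
      A $$ (2 * j + 1 + p, 2 * l + 1 + q) = B $$ (2 * j + 1 + p, 2 * l + 1 + q)"
  shows "A = B"
proof (rule eq_matI)
  fix i k assume "i < dim_row B" "k < dim_col B"
  then have "i < 2 * N + 3" "k < 2 * N + 3" using assms(2) by auto
  then show "A $$ (i, k) = B $$ (i, k)"
    by (elim index_cases) (simp_all only: assms(3-6))
qed (use assms(1,2) in auto)

section \<open>Invertibility of the rotation matrix\<close>

lemma T_rot_inverse: "T_rot N (- \<theta>) * T_rot N \<theta> = 1\<^sub>m (2 * N + 3)"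
proof (rule eq_mat_pairsI[where N = N])
  show "T_rot N (- \<theta>) * T_rot N \<theta> \<in> carrier_mat (2 * N + 3) (2 * N + 3)"
    by (rule mult_carrier_mat[OF T_rot_carrier T_rot_carrier])
  note ix = mult_mat_index_sum[OF T_rot_carrier T_rot_carrier]
  have z: "0 < 2 * N + 3" by simp
  show "(T_rot N (- \<theta>) * T_rot N \<theta>) $$ (0, 0) = 1\<^sub>m (2 * N + 3) $$ (0, 0)"
    unfolding ix[OF z z] T_rot_row_sum(1) by (simp add: T_rot_index(1))
  show "(T_rot N (- \<theta>) * T_rot N \<theta>) $$ (0, 2 * l + 1 + q) = 1\<^sub>m (2 * N + 3) $$ (0, 2 * l + 1 + q)"
    if "l \<le> N" "q < 2" for l q
    unfolding ix[OF z block_bound[OF that]] T_rot_row_sum(1) T_rot_index(2)[OF that]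
    using that by simp
  show "(T_rot N (- \<theta>) * T_rot N \<theta>) $$ (2 * j + 1 + p, 0) = 1\<^sub>m (2 * N + 3) $$ (2 * j + 1 + p, 0)"
    if "j \<le> N" "p < 2" for j p
    unfolding ix[OF block_bound[OF that] z] T_rot_row_sum(2)[OF that]
    using that T_rot_index(3)[of j N 0 \<theta>] T_rot_index(3)[of j N 1 \<theta>] by simp
  show "(T_rot N (- \<theta>) * T_rot N \<theta>) $$ (2 * j + 1 + p, 2 * l + 1 + q) =
      1\<^sub>m (2 * N + 3) $$ (2 * j + 1 + p, 2 * l + 1 + q)"
    if jp: "j \<le> N" "p < 2" and lq: "l \<le> N" "q < 2" for j p l q
  proof -
    have T: "T_rot N \<theta> $$ (2 * j + 1, 2 * l + 1 + q) = of_bool (j = l) * T_2 \<theta> $$ (0, q)"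
      "T_rot N \<theta> $$ (2 * j + 2, 2 * l + 1 + q) = of_bool (j = l) * T_2 \<theta> $$ (1, q)"
      using that T_rot_index(4)[of j N 0 l q \<theta>] T_rot_index(4)[of j N 1 l q \<theta>] by simp_all
    have "p = 0 \<or> p = 1" "q = 0 \<or> q = 1" using that by auto
    then have "T_2 (- \<theta>) $$ (p, 0) * T_2 \<theta> $$ (0, q) + T_2 (- \<theta>) $$ (p, 1) * T_2 \<theta> $$ (1, q) = of_bool (p = q)"
      using sin_cos_squared_add[of \<theta>]
      by (elim disjE; simp only: T_2_index) (simp_all add: power2_eq_square)
    then have "(T_rot N (- \<theta>) * T_rot N \<theta>) $$ (2 * j + 1 + p, 2 * l + 1 + q) =
      of_bool (j = l) * of_bool (p = q)"
      unfolding ix[OF block_bound[OF jp] block_bound[OF lq]] T_rot_row_sum(2)[OF jp] T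
      by (cases "j = l") simp_all
    then show ?thesis
      using block_bound[OF jp] block_bound[OF lq]
      by (simp only: index_one_mat pair_index_eq_iff[OF jp(2) lq(2)]) simp
  qed
qed simp

text \<open>\<open>mat_inverse\<close> returns an option, so \<open>the\<close> is meaningful only
  once \<open>None\<close> is excluded. The rotation by the opposite angle is a two-sided inverse,
  which makes \<open>T_rot\<close> a unit of the matrix ring and rules \<open>None\<close>
  out.\<close>

lemma mat_inverse_T_rot:
  "the (mat_inverse (T_rot N \<theta>)) \<in> carrier_mat (2 * N + 3) (2 * N + 3)"
  "the (mat_inverse (T_rot N \<theta>)) * T_rot N \<theta> = 1\<^sub>m (2 * N + 3)"
proof -
  have "T_rot N \<theta> * T_rot N (- \<theta>) = 1\<^sub>m (2 * N + 3)"
    using T_rot_inverse[of N "- \<theta>"] by simp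
  then have unit: "T_rot N \<theta> \<in> Units (ring_mat TYPE(real) (2 * N + 3) ())"
    using T_rot_carrier[of N \<theta>] T_rot_carrier[of N "- \<theta>"] T_rot_inverse[of N \<theta>]
    unfolding Units_def by (auto simp: ring_mat_simps)
  have "mat_inverse (T_rot N \<theta>) \<noteq> None"
  proof
    assume "mat_inverse (T_rot N \<theta>) = None"
    from mat_inverse(1)[OF T_rot_carrier this] unit show False by (rule notE)
  qed
  then obtain S where "mat_inverse (T_rot N \<theta>) = Some S" by auto
  then show "the (mat_inverse (T_rot N \<theta>)) \<in> carrier_mat (2 * N + 3) (2 * N + 3)"
    "the (mat_inverse (T_rot N \<theta>)) * T_rot N \<theta> = 1\<^sub>m (2 * N + 3)"
    using mat_inverse(2)[OF T_rot_carrier] by simp_all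
qed

section \<open>Equivariance under simultaneous rotation\<close>

text \<open>The rotation fixes \<open>h\<close>, so dividing by \<open>h\<close> commutes with it,
  and the pairs of quotients rotate exactly as the conserved pairs do.\<close>

lemma T_rot_vec_index:
  assumes "U \<in> carrier_vec (2 * N + 3)"
  shows "ht (T_rot N \<theta> *\<^sub>v U) = ht U"
    "j \<le> N \<Longrightarrow> p < 2 \<Longrightarrow> pair_comp (T_rot N \<theta> *\<^sub>v U) j p =
      T_2 \<theta> $$ (p, 0) * pair_comp U j 0 + T_2 \<theta> $$ (p, 1) * pair_comp U j 1"
proof -
  have "vec_index (T_rot N \<theta> *\<^sub>v U) i = (\<Sum>r<2 * N + 3. T_rot N \<theta> $$ (i, r) * vec_index U r)"
    if "i < 2 * N + 3" for i
    using that T_rot_carrier[of N \<theta>] assms by (auto simp: scalar_prod_def atLeast0LessThan)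
  note ix = this
  show ht: "ht (T_rot N \<theta> *\<^sub>v U) = ht U"
    unfolding ht_def by (subst ix) (simp_all add: T_rot_row_sum)
  show "pair_comp (T_rot N \<theta> *\<^sub>v U) j p = T_2 \<theta> $$ (p, 0) * pair_comp U j 0 + T_2 \<theta> $$ (p, 1) * pair_comp U j 1"
    if "j \<le> N" "p < 2"
    unfolding pair_comp_def ht using that
    by (subst ix) (simp_all add: T_rot_row_sum(2)[simplified] add_divide_distrib)
qed

text \<open>With \<open>R = T_2 \<theta>\<close> and \<open>m = R n\<close>, inner products are
  unchanged, multiples of the identity commute with \<open>R\<close>, and
  \<open>(R g) (R n)^T R = R (g n^T)\<close>. The intertwining form needs no inverse matrix.\<close>

lemma normal_mat_equivariant:
  assumes U: "U \<in> carrier_vec (2 * N + 3)"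
    and n: "\<And>p. p < 2 \<Longrightarrow> m p = T_2 \<theta> $$ (p, 0) * n 0 + T_2 \<theta> $$ (p, 1) * n 1"
  shows "T_rot N \<theta> * normal_mat N G n U = normal_mat N G m (T_rot N \<theta> *\<^sub>v U) * T_rot N \<theta>"
proof (rule eq_mat_pairsI[where N = N])
  let ?V = "T_rot N \<theta> *\<^sub>v U"
  have m: "m 0 = cos \<theta> * n 0 + sin \<theta> * n 1" "m 1 = - sin \<theta> * n 0 + cos \<theta> * n 1"
    using n[of 0] n[of 1] by (simp_all add: T_2_index[simplified])
  have c: "pair_comp ?V j 0 = cos \<theta> * pair_comp U j 0 + sin \<theta> * pair_comp U j 1"
    "pair_comp ?V j 1 = - sin \<theta> * pair_comp U j 0 + cos \<theta> * pair_comp U j 1" if "j \<le> N" for j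
    using T_rot_vec_index(2)[OF U that] by (simp_all add: T_2_index[simplified])
  have cs: "cos \<theta> * cos \<theta> = 1 - sin \<theta> * sin \<theta>"
    using sin_cos_squared_add[of \<theta>] by (simp add: power2_eq_square)
  have nc: "normal_comp m ?V j = normal_comp n U j" if "j \<le> N" for j
  proof -
    \<comment> \<open>With \<open>x\<close> the cosine and \<open>y\<close> the sine, rotating both
      vectors multiplies their inner product by \<open>x * x + y * y\<close>, which is 1.\<close>
    have "(x * a + y * b) * (x * d + y * e) + (- y * a + x * b) * (- y * d + x * e)
      = (x * x + y * y) * (a * d + b * e)" for x y a b d e :: real
      by (simp add: algebra_simps)
    then show ?thesis
      unfolding normal_comp_def m c[OF that] by (simp add: cs)
  qed
  show "T_rot N \<theta> * normal_mat N G n U \<in> carrier_mat (2 * N + 3) (2 * N + 3)"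
    "normal_mat N G m ?V * T_rot N \<theta> \<in> carrier_mat (2 * N + 3) (2 * N + 3)"
    by (rule mult_carrier_mat[OF T_rot_carrier normal_mat_carrier]
        mult_carrier_mat[OF normal_mat_carrier T_rot_carrier])+
  note ix = mult_mat_index_sum[OF T_rot_carrier normal_mat_carrier]
    mult_mat_index_sum[OF normal_mat_carrier T_rot_carrier]
  note sums = T_rot_row_sum T_rot_column_sum
  have mi: "normal_mat N G n U $$ (0, 2 * l + 1) = of_bool (l = 0) * n 0"
    "normal_mat N G n U $$ (0, 2 * l + 2) = of_bool (l = 0) * n 1"
    "normal_mat N G n U $$ (2 * l + 1, 0) = normal_mat_column N G n U l 0"
    "normal_mat N G n U $$ (2 * l + 2, 0) = normal_mat_column N G n U l 1"
    "q < 2 \<Longrightarrow> j \<le> N \<Longrightarrow>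
       normal_mat N G n U $$ (2 * l + 1, 2 * j + 1 + q) = normal_mat_block n U l 0 j q"
    "q < 2 \<Longrightarrow> j \<le> N \<Longrightarrow>
       normal_mat N G n U $$ (2 * l + 2, 2 * j + 1 + q) = normal_mat_block n U l 1 j q"
    "q < 2 \<Longrightarrow> j \<le> N \<Longrightarrow>
       normal_mat N G n U $$ (2 * j + 1 + q, 2 * l + 1) = normal_mat_block n U j q l 0"
    "q < 2 \<Longrightarrow> j \<le> N \<Longrightarrow>
       normal_mat N G n U $$ (2 * j + 1 + q, 2 * l + 2) = normal_mat_block n U j q l 1"
    if "l \<le> N" for l j q n U
    using that normal_mat_index(2)[of l N 0] normal_mat_index(2)[of l N 1]
      normal_mat_index(3)[of l N 0] normal_mat_index(3)[of l N 1]
      normal_mat_index(4)[of l N 0 j q] normal_mat_index(4)[of l N 1 j q]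
      normal_mat_index(4)[of j N q l 0] normal_mat_index(4)[of j N q l 1] by simp_all
  show "(T_rot N \<theta> * normal_mat N G n U) $$ (0, 0) = (normal_mat N G m ?V * T_rot N \<theta>) $$ (0, 0)"
    by (simp add: ix sums normal_mat_index)
  \<comment> \<open>This is \<open>m^T R = n^T\<close>, by orthogonality of \<open>R\<close>. It
    settles the row of \<open>h\<close> and the right factor of the rank-one terms.\<close>
  have n_back: "m 0 * T_2 \<theta> $$ (0, q) + m 1 * T_2 \<theta> $$ (1, q) = n q" if "q < 2" for q
  proof -
    have "q = 0 \<or> q = 1" using that by auto
    moreover have "(x * a + y * b) * x + (- y * a + x * b) * - y = (x * x + y * y) * a"
      "(x * a + y * b) * y + (- y * a + x * b) * x = (x * x + y * y) * b" for x y a b :: real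
      by (simp_all add: algebra_simps)
    then have "m 0 * cos \<theta> + m 1 * - sin \<theta> = (cos \<theta> * cos \<theta> + sin \<theta> * sin \<theta>) * n 0"
      "m 0 * sin \<theta> + m 1 * cos \<theta> = (cos \<theta> * cos \<theta> + sin \<theta> * sin \<theta>) * n 1"
      unfolding m by blast+
    ultimately show ?thesis
      by (elim disjE) (simp_all only: T_2_index cs diff_add_cancel mult_1)
  qed
  show "(T_rot N \<theta> * normal_mat N G n U) $$ (0, 2 * l + 1 + q) =
    (normal_mat N G m ?V * T_rot N \<theta>) $$ (0, 2 * l + 1 + q)" if "l \<le> N" "q < 2" for l q
  proof -
    have "of_bool (l = 0) * n q =
      of_bool (l = 0) * m 0 * T_2 \<theta> $$ (0, q) + of_bool (l = 0) * m 1 * T_2 \<theta> $$ (1, q)"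
      using n_back[OF that(2)] by simp
    then show ?thesis
      by (simp only: ix block_bound that sums normal_mat_index(2) mi)
  qed
  show "(T_rot N \<theta> * normal_mat N G n U) $$ (2 * j + 1 + p, 0) =
    (normal_mat N G m ?V * T_rot N \<theta>) $$ (2 * j + 1 + p, 0)" if "j \<le> N" "p < 2" for j p
  proof -
    have "T_2 \<theta> $$ (p, 0) * normal_mat_column N G n U j 0 + T_2 \<theta> $$ (p, 1) * normal_mat_column N G n U j 1
      = normal_mat_column N G m ?V j p"
    proof -
      \<comment> \<open>Naming row \<open>p\<close> of the rotation treats both values of
        \<open>p\<close> in one computation.\<close>
      define a b where "a = T_2 \<theta> $$ (p, 0)" and "b = T_2 \<theta> $$ (p, 1)"
      have mp: "m p = a * n 0 + b * n 1"
        and cp: "pair_comp ?V i p = a * pair_comp U i 0 + b * pair_comp U i 1" if "i \<le> N" for i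
        using n[OF \<open>p < 2\<close>] T_rot_vec_index(2)[OF U that \<open>p < 2\<close>] by (simp_all add: a_def b_def)
      \<comment> \<open>In each summand the normal component is an invariant scalar, so only the
        other factor rotates and the whole sum transforms as a vector.\<close>
      have "(\<Sum>l = 1..N. normal_comp m ?V l * pair_comp ?V l p / real (2 * l + 1)) =
        (\<Sum>l = 1..N. a * (normal_comp n U l * pair_comp U l 0 / real (2 * l + 1))
          + b * (normal_comp n U l * pair_comp U l 1 / real (2 * l + 1)))"
        by (intro sum.cong) (simp_all add: nc cp algebra_simps add_divide_distrib)
      also have "\<dots> = a * (\<Sum>l = 1..N. normal_comp n U l * pair_comp U l 0 / real (2 * l + 1))
        + b * (\<Sum>l = 1..N. normal_comp n U l * pair_comp U l 1 / real (2 * l + 1))"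
        by (simp only: sum.distrib sum_distrib_left)
      finally show ?thesis
        using that unfolding normal_mat_column_def a_def[symmetric] b_def[symmetric]
        by (simp add: nc cp mp[of 0] T_rot_vec_index(1)[OF U] algebra_simps del: One_nat_def)
    qed
    then show ?thesis
      by (simp only: ix block_bound that sums normal_mat_index(3) mi)
  qed
  show "(T_rot N \<theta> * normal_mat N G n U) $$ (2 * j + 1 + p, 2 * l + 1 + q) =
    (normal_mat N G m ?V * T_rot N \<theta>) $$ (2 * j + 1 + p, 2 * l + 1 + q)"
    if "j \<le> N" "p < 2" "l \<le> N" "q < 2" for j p l q
  proof -
    have "T_2 \<theta> $$ (p, 0) * normal_mat_block n U j 0 l q + T_2 \<theta> $$ (p, 1) * normal_mat_block n U j 1 l q
      = normal_mat_block m ?V j p l 0 * T_2 \<theta> $$ (0, q) + normal_mat_block m ?V j p l 1 * T_2 \<theta> $$ (1, q)"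
    proof -
      define a b where "a = T_2 \<theta> $$ (p, 0)" and "b = T_2 \<theta> $$ (p, 1)"
      have cp: "pair_comp ?V j p = a * pair_comp U j 0 + b * pair_comp U j 1"
        using T_rot_vec_index(2)[OF U that(1,2)] by (simp add: a_def b_def)
      \<comment> \<open>Entry \<open>(p, q)\<close> of \<open>I R = R I\<close>. Both sides equal
        \<open>T_2 \<theta> $$ (p, q)\<close>.\<close>
      have id: "of_bool (p = 0) * T_2 \<theta> $$ (0, q) + of_bool (p = 1) * T_2 \<theta> $$ (1, q)
        = a * of_bool (0 = q) + b * of_bool (1 = q)"
        using that(2,4) by (auto simp: a_def b_def less_2_cases_iff)
      \<comment> \<open>\<open>d\<close> and \<open>d'\<close> are the coefficients of the identity
        in the blocks with \<open>l > 0\<close>, before and after rotation. They agree because they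
        involve normal components only.\<close>
      define d where "d = (if j = 0 then 2 * normal_comp n U l / real (2 * l + 1)
        else of_bool (j = l) * normal_comp n U 0)"
      define d' where "d' = (if j = 0 then 2 * normal_comp m ?V l / real (2 * l + 1)
        else of_bool (j = l) * normal_comp m ?V 0)"
      have d': "d' = d" unfolding d_def d'_def using that by (simp add: nc)
      let ?D = "of_bool (p = 0) * T_2 \<theta> $$ (0, q) + of_bool (p = 1) * T_2 \<theta> $$ (1, q)"
      have "normal_mat_block m ?V j p l 0 * T_2 \<theta> $$ (0, q)
        + normal_mat_block m ?V j p l 1 * T_2 \<theta> $$ (1, q)
        = (if l = 0 then pair_comp ?V j p * (m 0 * T_2 \<theta> $$ (0, q) + m 1 * T_2 \<theta> $$ (1, q))
            + normal_comp m ?V j * ?D else d' * ?D)"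
        unfolding normal_mat_block_def d'_def[symmetric] by (simp add: algebra_simps)
      also have "\<dots> = a * normal_mat_block n U j 0 l q + b * normal_mat_block n U j 1 l q"
        unfolding n_back[OF that(4)] id cp d' nc[OF that(1)] normal_mat_block_def d_def[symmetric]
        by (simp add: algebra_simps)
      finally show ?thesis unfolding a_def b_def ..
    qed
    then show ?thesis
      by (simp only: ix block_bound that sums mi)
  qed
qed

section \<open>Directional derivatives of the flux\<close>

text \<open>The quotient rule along the \<open>k\<close>-th coordinate line: the numerator grows at
  rate \<open>of_bool (2 * j + 1 + p = k)\<close> and the denominator \<open>h\<close> at rate
  \<open>of_bool (k = 0)\<close>.\<close>

definition pair_comp_deriv :: "nat \<Rightarrow> real vec \<Rightarrow> nat \<Rightarrow> nat \<Rightarrow> real" where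
  "pair_comp_deriv k U j p = (of_bool (2 * j + 1 + p = k) - pair_comp U j p * of_bool (k = 0)) / ht U"

lemma perturbed_index:
  assumes "i < dim_vec U" "k < dim_vec U"
  shows "vec_index (U + t \<cdot>\<^sub>v unit_vec (dim_vec U) k) i = vec_index U i + t * of_bool (i = k)"
  using assms by simp

context
  fixes N k :: nat and U :: "real vec" and V :: "real \<Rightarrow> real vec"
  assumes U: "U \<in> state_space N" and k: "k < 2 * N + 3"
  defines "V \<equiv> \<lambda>t. U + t \<cdot>\<^sub>v unit_vec (dim_vec U) k"
begin

lemma dim_U: "dim_vec U = 2 * N + 3" and ht_pos: "ht U > 0" and V_0: "V 0 = U"
  using U by (auto simp: state_space_def ht_def V_def)

lemma ht_has_deriv: "((\<lambda>t. ht (V t)) has_real_derivative of_bool (k = 0)) (at 0)"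
proof -
  have "ht (V t) = ht U + t * of_bool (k = 0)" for t
    unfolding ht_def V_def by (subst perturbed_index) (use k in \<open>auto simp: dim_U\<close>)
  then show ?thesis by (auto intro!: derivative_eq_intros)
qed

lemma pair_comp_has_deriv:
  assumes "j \<le> N" "p < 2"
  shows "((\<lambda>t. pair_comp (V t) j p) has_real_derivative pair_comp_deriv k U j p) (at 0)"
proof -
  have "pair_comp (V t) j p = (vec_index U (2 * j + 1 + p) + t * of_bool (2 * j + 1 + p = k)) / ht (V t)" for t
    unfolding pair_comp_def V_def by (subst perturbed_index) (use assms k in \<open>auto simp: dim_U\<close>)
  moreover have "((\<lambda>t. (vec_index U (2 * j + 1 + p) + t * of_bool (2 * j + 1 + p = k)) / ht (V t))
    has_real_derivative pair_comp_deriv k U j p) (at 0)"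
    using ht_pos
    by (auto intro!: derivative_eq_intros ht_has_deriv
        simp: V_0 pair_comp_deriv_def pair_comp_def field_simps)
  ultimately show ?thesis by simp
qed

lemma normal_comp_has_deriv:
  assumes "j \<le> N"
  shows "((\<lambda>t. normal_comp n (V t) j) has_real_derivative
    n 0 * pair_comp_deriv k U j 0 + n 1 * pair_comp_deriv k U j 1) (at 0)"
  unfolding normal_comp_def
  by (intro DERIV_add DERIV_cmult pair_comp_has_deriv assms) simp_all

text \<open>The product rule, kept in terms of \<open>pair_comp_deriv\<close> so that a single
  formula covers differentiation in \<open>h\<close> and in every pair.\<close>

lemma normal_flux_entry_has_deriv:
  fixes n :: "nat \<Rightarrow> real"
  assumes "j \<le> N" "p < 2"
  defines "d \<equiv> \<lambda>l. n 0 * pair_comp_deriv k U l 0 + n 1 * pair_comp_deriv k U l 1"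
  shows "((\<lambda>t. normal_flux_entry N G n (V t) j p) has_real_derivative
    (if j = 0 then
       of_bool (k = 0) * (normal_comp n U 0 * pair_comp U 0 p
         + (\<Sum>l = 1..N. normal_comp n U l * pair_comp U l p / real (2 * l + 1)))
       + ht U * (d 0 * pair_comp U 0 p + normal_comp n U 0 * pair_comp_deriv k U 0 p
         + (\<Sum>l = 1..N. (d l * pair_comp U l p + normal_comp n U l * pair_comp_deriv k U l p) / real (2 * l + 1)))
       + G * ht U * n p * of_bool (k = 0)
     else
       of_bool (k = 0) * (normal_comp n U 0 * pair_comp U j p + normal_comp n U j * pair_comp U 0 p)
       + ht U * (d 0 * pair_comp U j p + normal_comp n U 0 * pair_comp_deriv k U j p
         + d j * pair_comp U 0 p + normal_comp n U j * pair_comp_deriv k U 0 p))) (at 0)"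
proof -
  have dn: "((\<lambda>t. normal_comp n (V t) l) has_real_derivative d l) (at 0)" if "l \<le> N" for l
    unfolding d_def by (rule normal_comp_has_deriv[OF that])
  define S where "S = (\<lambda>t. \<Sum>l = 1..N. normal_comp n (V t) l * pair_comp (V t) l p / real (2 * l + 1))"
  define S' where "S' = (\<Sum>l = 1..N. (d l * pair_comp U l p + normal_comp n U l * pair_comp_deriv k U l p) / real (2 * l + 1))"
  have S: "(S has_real_derivative S') (at 0)"
    unfolding S_def S'_def
  proof (intro DERIV_sum DERIV_cdivide)
    fix l assume "l \<in> {1..N}"
    then have "l \<le> N" by simp
    then show "((\<lambda>t. normal_comp n (V t) l * pair_comp (V t) l p) has_real_derivative
      d l * pair_comp U l p + normal_comp n U l * pair_comp_deriv k U l p) (at 0)"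
      using DERIV_mult[OF dn pair_comp_has_deriv[OF _ assms(2)]] by (simp add: V_0 mult.commute)
  qed
  \<comment> \<open>The product rule leaves the undifferentiated sum as its value \<open>S 0\<close>
    at the base point. The claim is brought to the same form.\<close>
  have S0: "(\<Sum>l = 1..N. normal_comp n U l * pair_comp U l p / real (2 * l + 1)) = S 0"
    by (simp add: S_def V_0)
  \<comment> \<open>The factor 2 from differentiating the square cancels the
    \<open>1 / 2\<close>.\<close>
  have gravity: "((\<lambda>t. 1 / 2 * G * (ht (V t))\<^sup>2 * n p) has_real_derivative
    G * ht U * n p * of_bool (k = 0)) (at 0)"
    using DERIV_cmult[OF DERIV_power[OF ht_has_deriv, of 2], of "1 / 2 * G * n p"]
    by (simp add: V_0 mult_ac)
  have entry: "normal_flux_entry N G n (V t) j p =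
    ht (V t) * (normal_comp n (V t) 0 * pair_comp (V t) 0 p + S t) + 1 / 2 * G * (ht (V t))\<^sup>2 * n p"
    if "j = 0" for t
    using that by (simp add: normal_flux_entry_def S_def)
  show ?thesis
  proof (cases "j = 0")
    case True
    show ?thesis
      unfolding entry[OF True] S'_def[symmetric] S0 if_P[OF True]
      by (rule DERIV_cong[OF DERIV_add[OF DERIV_mult[OF ht_has_deriv
            DERIV_add[OF DERIV_mult[OF dn[OF le0] pair_comp_has_deriv[OF le0 assms(2)]] S]] gravity]])
        (simp only: V_0 ac_simps)
  next
    case False
    show ?thesis
      unfolding normal_flux_entry_def if_not_P[OF False]
      by (rule DERIV_cong[OF DERIV_mult[OF ht_has_deriv DERIV_add[
            OF DERIV_mult[OF dn[OF le0] pair_comp_has_deriv[OF assms(1,2)]]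
              DERIV_mult[OF dn[OF assms(1)] pair_comp_has_deriv[OF le0 assms(2)]]]]])
        (simp only: V_0 ac_simps)
  qed
qed

end

section \<open>The Jacobian with its corrections\<close>

text \<open>\<open>deriv\<close> is defined by choice, so an entry of \<open>jacobian_mat\<close> is
  determined by exhibiting an actual derivative.\<close>

lemma jacobian_index_eqI:
  assumes "U \<in> carrier_vec m" "dim_vec (f U) = m" "i < m" "k < m"
    and "((\<lambda>t. vec_index (f (U + t \<cdot>\<^sub>v unit_vec (dim_vec U) k)) i) has_real_derivative D) (at 0)"
  shows "jacobian_mat f U $$ (i, k) = D"
  using assms DERIV_imp_deriv[OF assms(5)] by (simp add: jacobian_mat_def)

text \<open>For \<open>j, l > 0\<close> the Jacobian along \<open>n\<close> has blocks
  \<open>w n^T + (n . w) I\<close> at \<open>(j, j)\<close> and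
  \<open>(g_l n^T + (n . g_l) I) / (2 l + 1)\<close> at \<open>(0, l)\<close>. The blocks prescribed
  for \<open>P\<close> and \<open>D\<close> cancel both rank-one parts, and \<open>D\<close> also
  doubles the multiple of the identity at \<open>(0, l)\<close>.\<close>

lemma corrected_jacobian:
  fixes N :: nat and G :: real and n :: "nat \<Rightarrow> real" and U :: "real vec"
  assumes U: "U \<in> state_space N"
    and dim_f: "\<And>V. dim_vec (f V) = 2 * N + 3"
    and f0: "\<And>V. vec_index (f V) 0 = ht V * normal_comp n V 0"
    and f: "\<And>V j p. j \<le> N \<Longrightarrow> p < 2 \<Longrightarrow> vec_index (f V) (2 * j + 1 + p) = normal_flux_entry N G n V j p"
    and P: "P \<in> carrier_mat (2 * N + 3) (2 * N + 3)"
      "\<And>k. k < 2 * N + 3 \<Longrightarrow> P $$ (0, k) = 0" "\<And>i. i < 2 * N + 3 \<Longrightarrow> P $$ (i, 0) = 0"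
      "\<And>j p l q. j \<le> N \<Longrightarrow> p < 2 \<Longrightarrow> l \<le> N \<Longrightarrow> q < 2 \<Longrightarrow>
        P $$ (2 * j + 1 + p, 2 * l + 1 + q) = of_bool (j = l \<and> j \<noteq> 0) * - (n q * pair_comp U 0 p)"
    and D: "D \<in> carrier_mat (2 * N + 3) (2 * N + 3)"
      "\<And>k. k < 2 * N + 3 \<Longrightarrow> D $$ (0, k) = 0" "\<And>i. i < 2 * N + 3 \<Longrightarrow> D $$ (i, 0) = 0"
      "\<And>j p l q. j \<le> N \<Longrightarrow> p < 2 \<Longrightarrow> l \<le> N \<Longrightarrow> q < 2 \<Longrightarrow>
        D $$ (2 * j + 1 + p, 2 * l + 1 + q) = of_bool (j = 0 \<and> l \<noteq> 0) *
          ((of_bool (p = q) * normal_comp n U l - n q * pair_comp U l p) / real (2 * l + 1))"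
  shows "jacobian_mat f U + P + D = normal_mat N G n U"
proof -
  have carr: "U \<in> carrier_vec (2 * N + 3)" and h: "ht U > 0"
    using U by (auto simp: state_space_def ht_def)
  have J: "jacobian_mat f U \<in> carrier_mat (2 * N + 3) (2 * N + 3)"
    using carr by (auto simp: jacobian_mat_def dim_f)
  have J0: "jacobian_mat f U $$ (0, k) = of_bool (k = 0) * normal_comp n U 0
      + ht U * (n 0 * pair_comp_deriv k U 0 0 + n 1 * pair_comp_deriv k U 0 1)"
    if "k < 2 * N + 3" for k
  proof (rule jacobian_index_eqI[OF carr dim_f _ that])
    show "((\<lambda>t. vec_index (f (U + t \<cdot>\<^sub>v unit_vec (dim_vec U) k)) 0) has_real_derivative
       of_bool (k = 0) * normal_comp n U 0
      + ht U * (n 0 * pair_comp_deriv k U 0 0 + n 1 * pair_comp_deriv k U 0 1)) (at 0)"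
      unfolding f0
      using DERIV_mult[OF ht_has_deriv[OF U that] normal_comp_has_deriv[OF U that, of 0 n]]
      by (simp add: V_0[OF U that] mult.commute)
  qed simp
  have J1: "jacobian_mat f U $$ (2 * j + 1 + p, k) = D"
    if "j \<le> N" "p < 2" "k < 2 * N + 3"
      "((\<lambda>t. normal_flux_entry N G n (U + t \<cdot>\<^sub>v unit_vec (dim_vec U) k) j p) has_real_derivative D) (at 0)"
    for j p k D
    by (rule jacobian_index_eqI[OF carr dim_f block_bound[OF that(1,2)] that(3)])
      (use that in \<open>simp only: f\<close>)
  note J1 = J1[OF _ _ _ normal_flux_entry_has_deriv[OF U]]
  \<comment> \<open>From here the derivative formula is specialized: \<open>cd0\<close> and
    \<open>nd0\<close> differentiate in \<open>h\<close>, \<open>cd\<close> and \<open>nd\<close> in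
    a component of a pair.\<close>
  have cd0: "pair_comp_deriv 0 U j p = - pair_comp U j p / ht U" for j p
    by (simp add: pair_comp_deriv_def)
  have cd: "pair_comp_deriv (2 * l + 1 + q) U j p = of_bool (j = l) * of_bool (p = q) / ht U"
    if "p < 2" "q < 2" for j p l q
    unfolding pair_comp_deriv_def pair_index_eq_iff[OF that] by simp
  have nd0: "n 0 * pair_comp_deriv 0 U j 0 + n 1 * pair_comp_deriv 0 U j 1 = - normal_comp n U j / ht U" for j
    by (simp add: cd0 normal_comp_def algebra_simps add_divide_distrib diff_divide_distrib)
  have nd: "n 0 * pair_comp_deriv (2 * l + 1 + q) U j 0 + n 1 * pair_comp_deriv (2 * l + 1 + q) U j 1
    = of_bool (j = l) * n q / ht U" if "q < 2" for j l q
  proof -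
    have "q = 0 \<or> q = 1" using that by auto
    moreover have "pair_comp_deriv (2 * l + 1 + q) U j 0 = of_bool (j = l) * of_bool (0 = q) / ht U"
      "pair_comp_deriv (2 * l + 1 + q) U j 1 = of_bool (j = l) * of_bool (1 = q) / ht U"
      using that by (simp_all only: cd)
    ultimately show ?thesis by (elim disjE) simp_all
  qed
  have add: "(jacobian_mat f U + P + D) $$ (i, k) = jacobian_mat f U $$ (i, k) + P $$ (i, k) + D $$ (i, k)"
    if "i < 2 * N + 3" "k < 2 * N + 3" for i k
    using that J P(1) D(1) by simp
  have z: "0 < 2 * N + 3" by simp
  show ?thesis
  proof (rule eq_mat_pairsI[where N = N])
    show "jacobian_mat f U + P + D \<in> carrier_mat (2 * N + 3) (2 * N + 3)"
      using J P(1) D(1) by simp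
    show "normal_mat N G n U \<in> carrier_mat (2 * N + 3) (2 * N + 3)"
      by (rule normal_mat_carrier)
    \<comment> \<open>The first flux component is a combination of momenta, so its two product-rule
      terms for the \<open>h\<close>-derivative cancel.\<close>
    show "(jacobian_mat f U + P + D) $$ (0, 0) = normal_mat N G n U $$ (0, 0)"
      using h by (simp add: add P D J0 nd0[simplified] normal_mat_index)
    show "(jacobian_mat f U + P + D) $$ (0, 2 * l + 1 + q) = normal_mat N G n U $$ (0, 2 * l + 1 + q)"
      if "l \<le> N" "q < 2" for l q
      unfolding add[OF z block_bound[OF that]] P(2)[OF block_bound[OF that]]
        D(2)[OF block_bound[OF that]] J0[OF block_bound[OF that]] nd[OF that(2)]
        normal_mat_index(2)[OF that]
      using h by simp
    show "(jacobian_mat f U + P + D) $$ (2 * j + 1 + p, 0) = normal_mat N G n U $$ (2 * j + 1 + p, 0)"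
      if jp: "j \<le> N" "p < 2" for j p
    proof -
      \<comment> \<open>Each of the two quotients contributes a factor \<open>- 1 / h\<close>. After
        multiplication by \<open>h\<close> this gives -2, and the derivative of the outer factor
        \<open>h\<close> adds 1, which leaves the sign -1 of
        \<open>normal_mat_column\<close>.\<close>
      have "(\<Sum>l = 1..N. (- normal_comp n U l / ht U * pair_comp U l p
          + normal_comp n U l * (- pair_comp U l p / ht U)) / real (2 * l + 1))
        = - 2 / ht U * (\<Sum>l = 1..N. normal_comp n U l * pair_comp U l p / real (2 * l + 1))"
        unfolding sum_distrib_left using h by (intro sum.cong) (auto simp: field_simps)
      note sum = this
      show ?thesis
        unfolding add[OF block_bound[OF jp] z] P(3)[OF block_bound[OF jp]]
          D(3)[OF block_bound[OF jp]] J1[OF jp z z jp] nd0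
        unfolding cd0 sum
          normal_mat_index(3)[OF jp] normal_mat_column_def
        using h by (simp add: field_simps)
    qed
    show "(jacobian_mat f U + P + D) $$ (2 * j + 1 + p, 2 * l + 1 + q)
      = normal_mat N G n U $$ (2 * j + 1 + p, 2 * l + 1 + q)"
      if jp: "j \<le> N" "p < 2" and lq: "l \<le> N" "q < 2" for j p l q
    proof -
      \<comment> \<open>Only the summand \<open>i = l\<close> survives. Since the sum starts at 1,
        it vanishes altogether for \<open>l = 0\<close>, hence the factor
        \<open>of_bool (l \<noteq> 0)\<close> below.\<close>
      have "(\<Sum>i = 1..N. (of_bool (i = l) * n q / ht U * pair_comp U i p
          + normal_comp n U i * (of_bool (i = l) * of_bool (p = q) / ht U)) / real (2 * i + 1))
        = (\<Sum>i = 1..N. if i = l then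
            (n q * pair_comp U l p + of_bool (p = q) * normal_comp n U l) / ht U / real (2 * l + 1) else 0)"
        using h by (intro sum.cong) (auto simp: field_simps)
      also have "\<dots> = of_bool (l \<noteq> 0) *
          ((n q * pair_comp U l p + of_bool (p = q) * normal_comp n U l) / ht U / real (2 * l + 1))"
        using lq by simp
      finally have sum: "(\<Sum>i = 1..N. (of_bool (i = l) * n q / ht U * pair_comp U i p
          + normal_comp n U i * (of_bool (i = l) * of_bool (p = q) / ht U)) / real (2 * i + 1))
        = of_bool (l \<noteq> 0) *
          ((n q * pair_comp U l p + of_bool (p = q) * normal_comp n U l) / ht U / real (2 * l + 1))" .
      \<comment> \<open>Keeping the denominator opaque lets the simplifier combine the flux term
        with the correction over a common \<open>r\<close>.\<close>
      define r where "r = real (2 * l + 1)"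
      show ?thesis
        unfolding add[OF block_bound[OF jp] block_bound[OF lq]] P(4)[OF jp lq] D(4)[OF jp lq]
          J1[OF jp block_bound[OF lq] block_bound[OF lq] jp] nd[OF lq(2)] cd[OF jp(2) lq(2)] sum
          normal_mat_index(4)[OF jp lq] normal_mat_block_def r_def[symmetric]
        using h by (cases "j = 0"; cases "l = 0"; cases "p = q")
          (simp_all add: distrib_left add_divide_distrib diff_divide_distrib)
    qed
  qed
qed

section \<open>Identification of \<open>A_G\<close> and \<open>B_G\<close>\<close>

lemma row_zero_blocks_index:
  "row_zero_blocks N D \<in> carrier_mat (2 * N + 3) (2 * N + 3)"
  "k < 2 * N + 3 \<Longrightarrow> row_zero_blocks N D $$ (0, k) = 0"
  "i < 2 * N + 3 \<Longrightarrow> row_zero_blocks N D $$ (i, 0) = 0"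
  "j \<le> N \<Longrightarrow> p < 2 \<Longrightarrow> l \<le> N \<Longrightarrow> q < 2 \<Longrightarrow>
     row_zero_blocks N D $$ (2 * j + 1 + p, 2 * l + 1 + q) = of_bool (j = 0 \<and> l \<noteq> 0) * D l $$ (p, q)"
  by (auto simp: row_zero_blocks_def less_2_cases_iff)

text \<open>The formulas for \<open>alpha\<close> and \<open>beta\<close> at index 0 read off pair 0
  and so give the mean velocities, which allows uniform treatment of all pairs.\<close>

lemma pair_comp_simps:
  "pair_comp U j 0 = alpha j U" "pair_comp U j 1 = beta j U" "um U = alpha 0 U" "vm U = beta 0 U"
  by (simp_all add: pair_comp_def um_def vm_def alpha_def beta_def numeral_2_eq_2)

text \<open>The direction is \<open>n = (1, 0)\<close>. Here \<open>p_block\<close> is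
  \<open>- w n^T\<close>, and \<open>DA_block\<close> is
  \<open>((n . g_l) I - g_l n^T) / (2 l + 1)\<close>, whose upper row cancels to zero.\<close>

lemma A_G_eq_normal_mat:
  assumes "U \<in> state_space N"
  shows "A_G N G U = normal_mat N G (\<lambda>p. of_bool (p = 0)) U"
  unfolding A_G_def A_L_def P_1_def Delta_A_def
proof (rule corrected_jacobian[OF assms _ _ _ diag_zero_block_index(1-3)[OF p_q_block_carrier(1)] _
      row_zero_blocks_index(1-3)])
  show "dim_vec (F_L N G V) = 2 * N + 3"
    "vec_index (F_L N G V) 0 = ht V * normal_comp (\<lambda>p. of_bool (p = 0)) V 0" for V
    by (simp_all add: F_L_def normal_comp_def pair_comp_simps[simplified])
  show "vec_index (F_L N G V) (2 * j + 1 + p) = normal_flux_entry N G (\<lambda>p. of_bool (p = 0)) V j p"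
    if "j \<le> N" "p < 2" for V j p
    using that by (cases "j = 0")
      (auto simp: F_L_def normal_flux_entry_def normal_comp_def less_2_cases_iff
        power2_eq_square algebra_simps pair_comp_simps[simplified])
  show "diag_block_mat (0\<^sub>m 3 3 # replicate N (p_block U)) $$ (2 * j + 1 + p, 2 * l + 1 + q)
    = of_bool (j = l \<and> j \<noteq> 0) * - (of_bool (q = 0) * pair_comp U 0 p)"
    if "j \<le> N" "p < 2" "l \<le> N" "q < 2" for j p l q
    unfolding diag_zero_block_index(4)[OF p_q_block_carrier(1) that] using that
    by (auto simp: p_block_def mat_of_rows_list_def less_2_cases_iff pair_comp_simps[simplified])
  show "row_zero_blocks N (\<lambda>j. DA_block j U) $$ (2 * j + 1 + p, 2 * l + 1 + q)
    = of_bool (j = 0 \<and> l \<noteq> 0) * ((of_bool (p = q) * normal_comp (\<lambda>p. of_bool (p = 0)) U l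
        - of_bool (q = 0) * pair_comp U l p) / real (2 * l + 1))"
    if "j \<le> N" "p < 2" "l \<le> N" "q < 2" for j p l q
    unfolding row_zero_blocks_index(4)[OF that] using that
    by (auto simp: DA_block_def mat_of_rows_list_def less_2_cases_iff normal_comp_def
        pair_comp_simps[simplified])
qed

text \<open>The direction is \<open>n = (0, 1)\<close>: \<open>q_block\<close> is
  \<open>- w n^T\<close>, and in the correction block it is now the lower row that cancels.\<close>

lemma B_G_eq_normal_mat:
  assumes "U \<in> state_space N"
  shows "B_G N G U = normal_mat N G (\<lambda>p. of_bool (p = 1)) U"
  unfolding B_G_def B_L_def Q_1_def Delta_B_def
proof (rule corrected_jacobian[OF assms _ _ _ diag_zero_block_index(1-3)[OF p_q_block_carrier(2)] _
      row_zero_blocks_index(1-3)])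
  show "dim_vec (G_L N G V) = 2 * N + 3"
    "vec_index (G_L N G V) 0 = ht V * normal_comp (\<lambda>p. of_bool (p = 1)) V 0" for V
    by (simp_all add: G_L_def normal_comp_def pair_comp_simps[simplified])
  show "vec_index (G_L N G V) (2 * j + 1 + p) = normal_flux_entry N G (\<lambda>p. of_bool (p = 1)) V j p"
    if "j \<le> N" "p < 2" for V j p
    using that by (cases "j = 0")
      (auto simp: G_L_def normal_flux_entry_def normal_comp_def less_2_cases_iff
        power2_eq_square algebra_simps pair_comp_simps[simplified])
  show "diag_block_mat (0\<^sub>m 3 3 # replicate N (q_block U)) $$ (2 * j + 1 + p, 2 * l + 1 + q)
    = of_bool (j = l \<and> j \<noteq> 0) * - (of_bool (q = 1) * pair_comp U 0 p)"
    if "j \<le> N" "p < 2" "l \<le> N" "q < 2" for j p l q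
    unfolding diag_zero_block_index(4)[OF p_q_block_carrier(2) that] using that
    by (auto simp: q_block_def mat_of_rows_list_def less_2_cases_iff pair_comp_simps[simplified])
  show "row_zero_blocks N (\<lambda>j. DB_block j U) $$ (2 * j + 1 + p, 2 * l + 1 + q)
    = of_bool (j = 0 \<and> l \<noteq> 0) * ((of_bool (p = q) * normal_comp (\<lambda>p. of_bool (p = 1)) U l
        - of_bool (q = 1) * pair_comp U l p) / real (2 * l + 1))"
    if "j \<le> N" "p < 2" "l \<le> N" "q < 2" for j p l q
    unfolding row_zero_blocks_index(4)[OF that] using that
    by (auto simp: DB_block_def mat_of_rows_list_def less_2_cases_iff normal_comp_def
        pair_comp_simps[simplified])
qed

section \<open>Linearity in the direction, and the rotation identity\<close>

text \<open>For fixed \<open>U\<close>, every entry contains \<open>n\<close> exactly once, either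
  directly or inside one normal component. Hence combinations of \<open>A_G\<close> and
  \<open>B_G\<close> are again of the form \<open>normal_mat\<close>.\<close>

lemma normal_mat_linear:
  "a \<cdot>\<^sub>m normal_mat N G n U + b \<cdot>\<^sub>m normal_mat N G m U = normal_mat N G (\<lambda>p. a * n p + b * m p) U"
proof -
  have nc: "normal_comp (\<lambda>p. a * n p + b * m p) U j = a * normal_comp n U j + b * normal_comp m U j" for j
    by (simp add: normal_comp_def algebra_simps)
  have sum: "(\<Sum>l = 1..N. (a * x l + b * y l) * z l / w l)
    = a * (\<Sum>l = 1..N. x l * z l / w l) + b * (\<Sum>l = 1..N. y l * z l / w l)"
    for x y z w :: "nat \<Rightarrow> real"
    by (simp add: sum_distrib_left sum.distrib[symmetric] distrib_right add_divide_distrib mult.assoc)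
  have column: "normal_mat_column N G (\<lambda>p. a * n p + b * m p) U j p
    = a * normal_mat_column N G n U j p + b * normal_mat_column N G m U j p" for j p
    unfolding normal_mat_column_def nc sum by (simp add: algebra_simps)
  have block: "normal_mat_block (\<lambda>p. a * n p + b * m p) U j p l q
    = a * normal_mat_block n U j p l q + b * normal_mat_block m U j p l q" for j p l q
    by (cases "l = 0"; cases "p = q"; cases "j = 0")
      (simp_all add: normal_mat_block_def nc algebra_simps add_divide_distrib)
  have index: "(a \<cdot>\<^sub>m normal_mat N G n U + b \<cdot>\<^sub>m normal_mat N G m U) $$ (i, k)
    = a * normal_mat N G n U $$ (i, k) + b * normal_mat N G m U $$ (i, k)"
    if "i < 2 * N + 3" "k < 2 * N + 3" for i k
    using that normal_mat_carrier[of N G n U] normal_mat_carrier[of N G m U] by simp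
  have z: "0 < 2 * N + 3" by simp
  show ?thesis
  proof (rule eq_mat_pairsI[where N = N])
    show "a \<cdot>\<^sub>m normal_mat N G n U + b \<cdot>\<^sub>m normal_mat N G m U \<in> carrier_mat (2 * N + 3) (2 * N + 3)"
      by (intro add_carrier_mat smult_carrier_mat normal_mat_carrier)
  qed (simp_all only: index[OF z z] index[OF z block_bound] index[OF block_bound z]
      index[OF block_bound block_bound] normal_mat_index column block normal_mat_carrier,
      simp_all add: algebra_simps)
qed

theorem mainTheorem4:
  fixes N :: nat and G \<theta> :: real and U :: "real vec"
  assumes "N \<ge> 1" and "G > 0"
    and "0 \<le> \<theta>" and "\<theta> < 2 * pi"
    and "U \<in> state_space N"
  shows "cos \<theta> \<cdot>\<^sub>m A_G N G U + sin \<theta> \<cdot>\<^sub>m B_G N G U =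
    the (mat_inverse (T_rot N \<theta>)) * A_G N G (T_rot N \<theta> *\<^sub>v U) * T_rot N \<theta>"
proof -
  let ?S = "the (mat_inverse (T_rot N \<theta>))"
  \<comment> \<open>The direction \<open>(cos \<theta>, sin \<theta>)\<close>, written as the
    combination of unit vectors that \<open>normal_mat_linear\<close> produces.\<close>
  define n :: "nat \<Rightarrow> real" where "n = (\<lambda>p. cos \<theta> * of_bool (p = 0) + sin \<theta> * of_bool (p = 1))"
  define e :: "nat \<Rightarrow> real" where "e = (\<lambda>p. of_bool (p = 0))"
  let ?M = "normal_mat N G n U" and ?M' = "normal_mat N G e (T_rot N \<theta> *\<^sub>v U)"
  have U: "U \<in> carrier_vec (2 * N + 3)"
    using assms(5) by (simp add: state_space_def)
  \<comment> \<open>Positivity of \<open>h\<close> survives because the rotation fixes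
    \<open>h\<close>, so the identification of \<open>A_G\<close> also applies at the rotated
    state.\<close>
  have TU: "T_rot N \<theta> *\<^sub>v U \<in> state_space N"
    using assms(5) T_rot_vec_index(1)[OF U, of \<theta>] mult_mat_vec_carrier[OF T_rot_carrier U]
    by (simp add: state_space_def ht_def)
  \<comment> \<open>The rotation takes \<open>n\<close> to the first unit vector. This is why only
    \<open>A_G\<close> appears on the right-hand side.\<close>
  have "e p = T_2 \<theta> $$ (p, 0) * n 0 + T_2 \<theta> $$ (p, 1) * n 1" if "p < 2" for p
  proof -
    have "p = 0 \<or> p = 1" using that by auto
    then show ?thesis
      unfolding e_def n_def using sin_cos_squared_add[of \<theta>]
      by (elim disjE; simp only: T_2_index) (simp_all add: power2_eq_square)
  qed
  then have "T_rot N \<theta> * ?M = ?M' * T_rot N \<theta>"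
    by (rule normal_mat_equivariant[OF U])
  moreover have "?S * (T_rot N \<theta> * ?M) = ?M"
    by (simp only: assoc_mult_mat[OF mat_inverse_T_rot(1) T_rot_carrier normal_mat_carrier, symmetric]
      mat_inverse_T_rot(2) left_mult_one_mat[OF normal_mat_carrier])
  ultimately have "?M = ?S * ?M' * T_rot N \<theta>"
    by (simp only: assoc_mult_mat[OF mat_inverse_T_rot(1) normal_mat_carrier T_rot_carrier])
  then show ?thesis
    unfolding A_G_eq_normal_mat[OF assms(5)] A_G_eq_normal_mat[OF TU] B_G_eq_normal_mat[OF assms(5)]
      normal_mat_linear n_def e_def .
qed

end
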